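(* Let $\Gamma=\mathrm{SL}(2,\mathbb{Z})$ and $M_2=\mathrm{SL}(2,\mathbb{R})/\Gamma$. Let $g_1,g_2\in\mathrm{SL}(2,\mathbb{R})$ and $m_1=g_1\Gamma$, $m_2=g_2\Gamma\in M_2$. If $g_1^{-1}g_2\in\mathrm{SL}(2,\mathbb{Q})$, then $m_1$ and $m_2$ are not finitely blockable from each other. In particular, the set of non-blockable pairs is a dense subset of $M_2\times M_2$.
   Context: Let $G$ be a connected Lie group with Lie algebra $\mathfrak{g}$ and exponential map $\exp$, let $\Gamma\subset G$ be a lattice, and let $M=G/\Gamma$ with $G$ acting by left multiplication. For (not necessarily distinct) $m_1,m_2\in M$, the connecting curves for the pair $m_1,m_2$ are the parametrized curves $c(t)=\exp(tX)\cdot m$, $0\le t\le 1$, with $X\in\mathfrak{g}$, $m\in M$, such that $c(0)=m_1$ and $c(1)=m_2$. A finite set $B\subset M\setminus\{m_1,m_2\}$ is a blocking set for the pair if $c([0,1])\cap B\neq\emptyset$ for every connecting curve $c$ of the pair. The pair $m_1,m_2$ is (finitely, connection) blockable if a blocking set exists, and non-blockable otherwise; one also says that $m_1$ and $m_2$ are (not) finitely blockable from each other. *)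

theory Defs
  imports "HOL-Analysis.Analysis" "HOL-Algebra.Left_Coset"
begin

text \<open>
  The overloaded product and \<^const>\<open>exp\<close> are not those of matrices on \<^typ>\<open>real^'n^'n\<close> (the product
  is componentwise), so the exponential series is written with iterated \<^const>\<open>matrix_matrix_mult\<close>.
\<close>

definition mat_exp :: "real^'n^'n \<Rightarrow> real^'n^'n" where
  "mat_exp X = (\<Sum>k. (1 / fact k) *\<^sub>R (((**) X ^^ k) (mat 1)))"

text \<open>
  The Lie algebra of a closed linear group \<open>G\<close>, as the set of generators of its one-parameter
  subgroups. Only the carrier of \<open>G\<close> enters; its product is meant to be the matrix product.
\<close>

definition lie_algebra :: "(real^'n^'n) monoid \<Rightarrow> (real^'n^'n) set" where
  "lie_algebra G = {X. \<forall>t. mat_exp (t *\<^sub>R X) \<in> carrier G}"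

text \<open>
  In the following, \<open>lcosets\<^bsub>G\<^esub> \<Gamma>\<close> is the homogeneous space \<open>G/\<Gamma>\<close>. A left coset \<open>m\<close> is a set
  of matrices, and \<open>h <#\<^bsub>G\<^esub> m\<close> is its translate, so that the same operation also is the action
  of \<open>G\<close> on \<open>G/\<Gamma>\<close> by left multiplication. Only the values of a curve on \<open>[0,1]\<close> matter.
\<close>

definition connecting_curve ::
  "(real^'n^'n) monoid \<Rightarrow> (real^'n^'n) set \<Rightarrow> (real^'n^'n) set \<Rightarrow> (real^'n^'n) set
    \<Rightarrow> (real \<Rightarrow> (real^'n^'n) set) \<Rightarrow> bool" where
  "connecting_curve G \<Gamma> m1 m2 c \<longleftrightarrow>
     (\<exists>X\<in>lie_algebra G. \<exists>m\<in>lcosets\<^bsub>G\<^esub> \<Gamma>. \<forall>t\<in>{0..1}. c t = mat_exp (t *\<^sub>R X) <#\<^bsub>G\<^esub> m)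
     \<and> c 0 = m1 \<and> c 1 = m2"

definition blocking_set ::
  "(real^'n^'n) monoid \<Rightarrow> (real^'n^'n) set \<Rightarrow> (real^'n^'n) set \<Rightarrow> (real^'n^'n) set
    \<Rightarrow> (real^'n^'n) set set \<Rightarrow> bool" where
  "blocking_set G \<Gamma> m1 m2 B \<longleftrightarrow>
     finite B \<and> B \<subseteq> (lcosets\<^bsub>G\<^esub> \<Gamma>) - {m1, m2} \<and>
     (\<forall>c. connecting_curve G \<Gamma> m1 m2 c \<longrightarrow> c ` {0..1} \<inter> B \<noteq> {})"

definition blockable ::
  "(real^'n^'n) monoid \<Rightarrow> (real^'n^'n) set \<Rightarrow> (real^'n^'n) set \<Rightarrow> (real^'n^'n) set \<Rightarrow> bool" where
  "blockable G \<Gamma> m1 m2 \<longleftrightarrow> (\<exists>B. blocking_set G \<Gamma> m1 m2 B)"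

definition coset_topology ::
  "(real^'n^'n) monoid \<Rightarrow> (real^'n^'n) set \<Rightarrow> (real^'n^'n) set topology" where
  "coset_topology G \<Gamma> = topology (\<lambda>U. U \<subseteq> lcosets\<^bsub>G\<^esub> \<Gamma> \<and>
     openin (top_of_set (carrier G)) {g \<in> carrier G. g <#\<^bsub>G\<^esub> \<Gamma> \<in> U})"

lemma openin_coset_topology:
  "openin (coset_topology G \<Gamma>) U \<longleftrightarrow> U \<subseteq> lcosets\<^bsub>G\<^esub> \<Gamma> \<and>
     openin (top_of_set (carrier G)) {g \<in> carrier G. g <#\<^bsub>G\<^esub> \<Gamma> \<in> U}"
proof -
  let ?p = "\<lambda>U. {g \<in> carrier G. g <#\<^bsub>G\<^esub> \<Gamma> \<in> U}"
  have "istopology (\<lambda>U. U \<subseteq> lcosets\<^bsub>G\<^esub> \<Gamma> \<and> openin (top_of_set (carrier G)) (?p U))"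
    unfolding istopology_def
  proof (intro conjI allI impI)
    fix S T
    assume "S \<subseteq> lcosets\<^bsub>G\<^esub> \<Gamma> \<and> openin (top_of_set (carrier G)) (?p S)"
      and "T \<subseteq> lcosets\<^bsub>G\<^esub> \<Gamma> \<and> openin (top_of_set (carrier G)) (?p T)"
    then have "openin (top_of_set (carrier G)) (?p S \<inter> ?p T)" by blast
    moreover have "?p S \<inter> ?p T = ?p (S \<inter> T)" by blast
    ultimately show "openin (top_of_set (carrier G)) (?p (S \<inter> T))" by simp
  next
    fix K
    assume "\<forall>S\<in>K. S \<subseteq> lcosets\<^bsub>G\<^esub> \<Gamma> \<and> openin (top_of_set (carrier G)) (?p S)"
    then have "openin (top_of_set (carrier G)) (\<Union> (?p ` K))" by blast
    moreover have "\<Union> (?p ` K) = ?p (\<Union> K)" by blast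
    ultimately show "openin (top_of_set (carrier G)) (?p (\<Union> K))" by simp
  qed blast+
  then show ?thesis unfolding coset_topology_def by (simp add: topology_inverse')
qed

lemma topspace_coset_topology: "topspace (coset_topology G \<Gamma>) = lcosets\<^bsub>G\<^esub> \<Gamma>"
proof
  show "topspace (coset_topology G \<Gamma>) \<subseteq> lcosets\<^bsub>G\<^esub> \<Gamma>"
    using openin_topspace openin_coset_topology by blast
  have "{g \<in> carrier G. g <#\<^bsub>G\<^esub> \<Gamma> \<in> lcosets\<^bsub>G\<^esub> \<Gamma>} = carrier G"
    by (auto simp: LCOSETS_def)
  then have "openin (coset_topology G \<Gamma>) (lcosets\<^bsub>G\<^esub> \<Gamma>)"
    by (simp add: openin_coset_topology)
  then show "lcosets\<^bsub>G\<^esub> \<Gamma> \<subseteq> topspace (coset_topology G \<Gamma>)"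
    by (rule openin_subset)
qed

lemma quotient_map_coset_topology:
  "quotient_map (top_of_set (carrier G)) (coset_topology G \<Gamma>) (\<lambda>g. g <#\<^bsub>G\<^esub> \<Gamma>)"
  by (auto simp: quotient_map_def topspace_coset_topology openin_coset_topology LCOSETS_def)

definition SL2R :: "(real^2^2) monoid" where
  "SL2R = \<lparr>carrier = {A. det A = 1}, mult = (**), one = mat 1\<rparr>"

definition SL2Z :: "(real^2^2) set" where
  "SL2Z = {A \<in> carrier SL2R. \<forall>i j. A $ i $ j \<in> \<int>}"

definition SL2Q :: "(real^2^2) set" where
  "SL2Q = {A \<in> carrier SL2R. \<forall>i j. A $ i $ j \<in> \<rat>}"

abbreviation M2 :: "(real^2^2) set set" where
  "M2 \<equiv> lcosets\<^bsub>SL2R\<^esub> SL2Z"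

abbreviation M2_topology :: "(real^2^2) set topology" where
  "M2_topology \<equiv> coset_topology SL2R SL2Z"

lemma group_SL2R: "group SL2R"
proof (rule groupI)
  fix A :: "real^2^2"
  assume "A \<in> carrier SL2R"
  then have d: "det A = 1" by (simp add: SL2R_def)
  then have "invertible A" by (simp add: invertible_det_nz)
  then obtain B where B: "B ** A = mat 1" unfolding invertible_def by blast
  then have "det B = 1" using d by (metis det_I det_mul mult.right_neutral)
  with B show "\<exists>B\<in>carrier SL2R. B \<otimes>\<^bsub>SL2R\<^esub> A = \<one>\<^bsub>SL2R\<^esub>" by (auto simp: SL2R_def)
qed (auto simp: SL2R_def det_mul matrix_mul_assoc)

end

theory Submission
  imports Defs
begin

text \<open>
  Put \<open>q = g1\<inverse> g2\<close>. The coset \<open>q \<Gamma>\<close> contains hyperbolic matrices \<open>A\<^sub>n = [[0, g], [-1/g, \<tau>\<^sub>n]]\<close> with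
  rational entries, \<open>g\<close> fixed and traces \<open>\<tau>\<^sub>n\<close> tending to infinity. The one-parameter group through
  \<open>A\<^sub>n\<close> gives a connecting curve, and its points between the two ends are \<open>g1 (\<alpha> I + \<beta> A\<^sub>n) \<Gamma>\<close> with
  \<open>\<alpha>, \<beta> > 0\<close> and \<open>\<alpha>\<^sup>2 + \<alpha> \<beta> \<tau>\<^sub>n + \<beta>\<^sup>2 = 1\<close>. If a finite set blocked all of these curves, infinitely many
  of them would pass through one point \<open>b\<close>. Comparing two of these curves shows that \<open>\<alpha>\<^sub>1 \<beta>\<^sub>1\<close> and \<open>\<beta>\<^sub>1\<^sup>2\<close>
  are rational for the first one. Hence there is an integer \<open>k > 0\<close> such that \<open>p = k \<beta>\<^sub>1 \<alpha>\<close> and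
  \<open>s = k \<beta>\<^sub>1 \<beta>\<close> are positive integers for every curve through \<open>b\<close>. Then
  \<open>\<tau>\<^sub>n \<le> p\<^sup>2 + p s \<tau>\<^sub>n + s\<^sup>2 = (k \<beta>\<^sub>1)\<^sup>2\<close>, so that the traces are bounded, a contradiction.
  The density statement follows because \<open>SL(2,\<rat>)\<close> is dense in \<open>SL(2,\<real>)\<close>.
\<close>

section \<open>Two-by-two matrices and the groups over the integers, rationals and reals\<close>

definition mat2 :: "real \<Rightarrow> real \<Rightarrow> real \<Rightarrow> real \<Rightarrow> real^2^2" where
  "mat2 a b c d = vector [vector [a, b], vector [c, d]]"

lemma mat2_nth [simp]:
  "mat2 a b c d $ 1 $ 1 = a" "mat2 a b c d $ 1 $ 2 = b"
  "mat2 a b c d $ 2 $ 1 = c" "mat2 a b c d $ 2 $ 2 = d"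
  by (simp_all add: mat2_def)

lemma mat2_eta: "A = mat2 (A $ 1 $ 1) (A $ 1 $ 2) (A $ 2 $ 1) (A $ 2 $ 2)"
  by (simp add: vec_eq_iff forall_2)

lemma mat2_eq_iff: "mat2 a b c d = mat2 a' b' c' d' \<longleftrightarrow> a = a' \<and> b = b' \<and> c = c' \<and> d = d'"
  by (auto simp: vec_eq_iff forall_2)

lemma mat2_mult:
  "mat2 a b c d ** mat2 a' b' c' d' =
     mat2 (a * a' + b * c') (a * b' + b * d') (c * a' + d * c') (c * b' + d * d')"
  by (simp add: vec_eq_iff forall_2 matrix_matrix_mult_def sum_2)

lemma det_mat2: "det (mat2 a b c d) = a * d - b * c"
  by (simp add: det_2)

lemma mat_1_eq_mat2: "mat 1 = mat2 1 0 0 1"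
  by (simp add: vec_eq_iff forall_2 mat_def)

lemma mat2_add: "mat2 a b c d + mat2 a' b' c' d' = mat2 (a + a') (b + b') (c + c') (d + d')"
  by (simp add: vec_eq_iff forall_2)

lemma mat2_scaleR: "k *\<^sub>R mat2 a b c d = mat2 (k * a) (k * b) (k * c) (k * d)"
  by (simp add: vec_eq_iff forall_2)

lemma carrier_SL2R: "A \<in> carrier SL2R \<longleftrightarrow> det A = 1"
  by (simp add: SL2R_def)

lemma mult_SL2R [simp]: "A \<otimes>\<^bsub>SL2R\<^esub> B = A ** B"
  by (simp add: SL2R_def)

lemma one_SL2R: "\<one>\<^bsub>SL2R\<^esub> = mat 1"
  by (simp add: SL2R_def)

lemma mat2_in_SL2Z: "mat2 a b c d \<in> SL2Z \<longleftrightarrow>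
    a * d - b * c = 1 \<and> a \<in> \<int> \<and> b \<in> \<int> \<and> c \<in> \<int> \<and> d \<in> \<int>"
  by (auto simp: SL2Z_def carrier_SL2R det_mat2 forall_2)

lemma mat2_in_SL2Q: "mat2 a b c d \<in> SL2Q \<longleftrightarrow>
    a * d - b * c = 1 \<and> a \<in> \<rat> \<and> b \<in> \<rat> \<and> c \<in> \<rat> \<and> d \<in> \<rat>"
  by (auto simp: SL2Q_def carrier_SL2R det_mat2 forall_2)

lemma SL2R_inverse:
  assumes "g1 \<in> carrier SL2R"
  obtains g1' where "g1' \<in> carrier SL2R" "g1 ** g1' = mat 1" "g1' ** g1 = mat 1"
  using that[of "inv\<^bsub>SL2R\<^esub> g1"] assms group.inv_closed[OF group_SL2R assms]
    group.r_inv[OF group_SL2R assms] group.l_inv[OF group_SL2R assms]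
  by (simp add: one_SL2R)

lemma subgroup_SL2Z: "subgroup SL2Z SL2R"
proof -
  interpret group SL2R by (rule group_SL2R)
  show ?thesis
  proof (rule subgroupI)
    show "SL2Z \<subseteq> carrier SL2R" by (auto simp: SL2Z_def)
    have "mat 1 \<in> SL2Z" by (simp add: mat_1_eq_mat2 mat2_in_SL2Z)
    then show "SL2Z \<noteq> {}" by blast
  next
    fix A assume A: "A \<in> SL2Z"
    obtain a b c d where e: "A = mat2 a b c d" using mat2_eta by blast
    have "inv\<^bsub>SL2R\<^esub> A = mat2 d (-b) (-c) a"
      by (rule inv_equality) (use A in \<open>auto simp: e mat2_in_SL2Z mat2_mult one_SL2R mat_1_eq_mat2
        mat2_eq_iff carrier_SL2R det_mat2 algebra_simps\<close>)
    then show "inv\<^bsub>SL2R\<^esub> A \<in> SL2Z" using A by (simp add: e mat2_in_SL2Z algebra_simps)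
  next
    fix A B assume A: "A \<in> SL2Z" and B: "B \<in> SL2Z"
    have "A ** B \<in> carrier SL2R" using A B by (simp add: SL2Z_def carrier_SL2R det_mul)
    moreover have "(A ** B) $ i $ j \<in> \<int>" for i j
      using A B by (simp add: matrix_matrix_mult_def SL2Z_def sum_2)
    ultimately show "A \<otimes>\<^bsub>SL2R\<^esub> B \<in> SL2Z" by (simp add: SL2Z_def)
  qed
qed

section \<open>Exponentials of matrices with scalar square\<close>

lemma scaleR_matrix_mult:
  fixes A :: "real^'m^'n"
  shows "(k *\<^sub>R A) ** B = k *\<^sub>R (A ** B)" "A ** (k *\<^sub>R C) = k *\<^sub>R (A ** C)"
  by (simp_all add: matrix_scalar_ac flip: scalar_matrix_assoc)

lemma matrix_add_rdistrib: "(A + B) ** C = A ** C + B ** C"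
  by (simp add: matrix_matrix_mult_def vec_eq_iff sum.distrib distrib_right)

text \<open>Even powers of \<open>X\<close> are scalar and odd powers are multiples of
  \<open>X\<close>, so the exponential series splits into the series of cosh and sinh.\<close>

lemma mat_exp_scaleR_of_square_scalar:
  fixes X :: "real^'n^'n"
  assumes X: "X ** X = l\<^sup>2 *\<^sub>R mat 1" and l: "l \<noteq> 0"
  shows "mat_exp (t *\<^sub>R X) = cosh (t * l) *\<^sub>R mat 1 + (sinh (t * l) / l) *\<^sub>R X"
proof -
  have pow: "((**) (t *\<^sub>R X) ^^ k) (mat 1) =
      (if even k then (t * l) ^ k *\<^sub>R mat 1 else ((t * l) ^ k / l) *\<^sub>R X)" for k
  proof (induction k)
    case (Suc k)
    then show ?case using l
      by (auto simp: matrix_scalar_ac X power2_eq_square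
          simp flip: scalar_matrix_assoc)
  qed simp
  have "(\<lambda>k. (if even k then (t * l) ^ k /\<^sub>R fact k else 0) *\<^sub>R (mat 1 :: real^'n^'n)
      + ((if even k then 0 else (t * l) ^ k /\<^sub>R fact k) / l) *\<^sub>R X)
      sums (cosh (t * l) *\<^sub>R mat 1 + (sinh (t * l) / l) *\<^sub>R X)"
    by (intro sums_add sums_scaleR_left sums_divide cosh_converges sinh_converges)
  moreover have "(\<lambda>k. (if even k then (t * l) ^ k /\<^sub>R fact k else 0) *\<^sub>R (mat 1 :: real^'n^'n)
      + ((if even k then 0 else (t * l) ^ k /\<^sub>R fact k) / l) *\<^sub>R X)
      = (\<lambda>k. (1 / fact k) *\<^sub>R (((**) (t *\<^sub>R X) ^^ k) (mat 1)))"
    by (auto simp: pow divide_simps fun_eq_iff)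
  ultimately show ?thesis unfolding mat_exp_def by (simp add: sums_iff)
qed

section \<open>Common denominators\<close>

lemma Rats_denominator:
  fixes x :: real
  assumes "x \<in> \<rat>"
  obtains k :: nat where "k > 0" "real k * x \<in> \<int>"
proof -
  obtain i :: int and k :: nat where "k \<noteq> 0" "x = of_int i / real k"
    using assms unfolding Rats_eq_int_div_nat by blast
  then show ?thesis using that[of k] by simp
qed

lemma Rats_common_denominator:
  fixes X :: "real set"
  assumes "finite X" "X \<subseteq> \<rat>"
  obtains k :: nat where "k > 0" "\<And>x. x \<in> X \<Longrightarrow> real k * x \<in> \<int>"
proof -
  have "\<exists>k::nat. k > 0 \<and> (\<forall>x\<in>X. real k * x \<in> \<int>)"
    using assms
  proof (induction X)
    case empty
    then show ?case by auto
  next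
    case (insert y X)
    then obtain k :: nat where k: "k > 0" "\<forall>x\<in>X. real k * x \<in> \<int>" by auto
    obtain l :: nat where l: "l > 0" "real l * y \<in> \<int>"
      using insert.prems Rats_denominator by auto
    have "real (k * l) * x \<in> \<int>" if "x \<in> insert y X" for x
    proof (cases "x = y")
      case True
      have "real k * (real l * y) \<in> \<int>" using l by simp
      then show ?thesis by (simp add: True mult.assoc)
    next
      case False
      then have "real l * (real k * x) \<in> \<int>" using k that by simp
      then show ?thesis by (simp add: mult_ac)
    qed
    then show ?case using k(1) l(1) by (metis nat_0_less_mult_iff)
  qed
  then show ?thesis using that by blast
qed

section \<open>Arithmetic of the matrices on the curves\<close>

text \<open>\<open>pencil g \<tau> \<alpha> \<beta> = \<alpha> I + \<beta> [[0, g], [-1/g, \<tau>]]\<close>.\<close>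

definition pencil :: "real \<Rightarrow> real \<Rightarrow> real \<Rightarrow> real \<Rightarrow> real^2^2" where
  "pencil g \<tau> \<alpha> \<beta> = mat2 \<alpha> (\<beta> * g) (- \<beta> / g) (\<alpha> + \<beta> * \<tau>)"

lemma det_pencil: "g \<noteq> 0 \<Longrightarrow> det (pencil g \<tau> \<alpha> \<beta>) = \<alpha>\<^sup>2 + \<alpha> * \<beta> * \<tau> + \<beta>\<^sup>2"
  by (simp add: pencil_def det_mat2 power2_eq_square algebra_simps)

text \<open>The integer entries of \<delta> are bilinear in the two coefficient pairs, with rational
  constants. Solving for \<open>\<beta>1 * \<beta>2\<close> and \<open>\<alpha>1 * \<beta>2\<close>
  makes the ratio \<open>\<alpha>1 / \<beta>1\<close> rational, and the determinant equation then
  fixes \<open>\<beta>1\<^sup>2\<close> as a rational number.\<close>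

lemma pencil_coeffs_rational:
  assumes g: "g \<in> \<rat>" "g \<noteq> 0" and \<tau>: "\<tau>1 \<in> \<rat>" "\<tau>2 \<in> \<rat>" "\<tau>1 \<noteq> \<tau>2"
    and d1: "det (pencil g \<tau>1 \<alpha>1 \<beta>1) = 1"
    and nz: "\<beta>1 \<noteq> 0" "\<beta>2 \<noteq> 0"
    and \<delta>: "\<delta> \<in> SL2Z" and eq: "pencil g \<tau>1 \<alpha>1 \<beta>1 ** \<delta> = pencil g \<tau>2 \<alpha>2 \<beta>2"
  shows "\<alpha>1 * \<beta>1 \<in> \<rat>" "\<beta>1\<^sup>2 \<in> \<rat>"
proof -
  have D: "\<alpha>1 * \<alpha>1 + \<alpha>1 * \<beta>1 * \<tau>1 + \<beta>1 * \<beta>1 = 1"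
    using d1 g by (simp add: det_pencil power2_eq_square)
  \<comment> \<open>The left factor is the adjugate, hence the inverse since the determinant is
    1.\<close>
  have Dm: "mat2 (\<alpha>1 + \<beta>1 * \<tau>1) (- (\<beta>1 * g)) (\<beta>1 / g) \<alpha>1 ** pencil g \<tau>1 \<alpha>1 \<beta>1 = mat 1"
    using D g by (simp add: pencil_def mat2_mult mat_1_eq_mat2 mat2_eq_iff algebra_simps)
  have "\<delta> = mat2 (\<alpha>1 + \<beta>1 * \<tau>1) (- (\<beta>1 * g)) (\<beta>1 / g) \<alpha>1 ** pencil g \<tau>2 \<alpha>2 \<beta>2"
    by (metis Dm eq matrix_mul_assoc matrix_mul_lid)
  also have "\<dots> = mat2 (\<alpha>1 * \<alpha>2 + \<beta>1 * \<alpha>2 * \<tau>1 + \<beta>1 * \<beta>2)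
     (g * (\<alpha>1 * \<beta>2 - \<beta>1 * \<alpha>2 + \<beta>1 * \<beta>2 * (\<tau>1 - \<tau>2)))
     ((\<beta>1 * \<alpha>2 - \<alpha>1 * \<beta>2) / g) (\<beta>1 * \<beta>2 + \<alpha>1 * \<alpha>2 + \<alpha>1 * \<beta>2 * \<tau>2)" (is "_ = mat2 ?a ?b ?c ?d")
    using g by (simp add: pencil_def mat2_mult mat2_eq_iff field_simps)
  finally have Z: "?a \<in> \<int>" "?b \<in> \<int>" "?c \<in> \<int>" "?d \<in> \<int>"
    using \<delta> by (simp_all add: mat2_in_SL2Z)
  then have Q: "?a \<in> \<rat>" "?b \<in> \<rat>" "?c \<in> \<rat>" "?d \<in> \<rat>"
    using Ints_subset_Rats by blast+
  \<comment> \<open>The mixed products cancel in \<open>?b / g + ?c * g\<close>, which leaves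
    \<open>\<beta>1 * \<beta>2 * (\<tau>1 - \<tau>2)\<close>; distinct traces allow the
    division.\<close>
  have "\<beta>1 * \<beta>2 = (?b / g + ?c * g) / (\<tau>1 - \<tau>2)"
    using g \<tau> by (simp add: field_simps)
  then have bb: "\<beta>1 * \<beta>2 \<in> \<rat>" using Q g \<tau> by (metis Rats_add Rats_diff Rats_divide Rats_mult)
  have "\<alpha>1 * \<beta>2 = (?a - ?d - ?c * g * \<tau>1) / (\<tau>1 - \<tau>2)"
    using g \<tau> by (simp add: field_simps)
  then have ab: "\<alpha>1 * \<beta>2 \<in> \<rat>" using Q g \<tau> by (metis Rats_diff Rats_divide Rats_mult)
  define r where "r = \<alpha>1 / \<beta>1"
  have "r = \<alpha>1 * \<beta>2 / (\<beta>1 * \<beta>2)" using nz by (simp add: r_def)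
  then have r: "r \<in> \<rat>" using Rats_divide[OF ab bb] by simp
  have \<alpha>: "\<alpha>1 = r * \<beta>1" using nz by (simp add: r_def)
  have E: "\<beta>1\<^sup>2 * (r\<^sup>2 + r * \<tau>1 + 1) = 1" using D by (simp add: \<alpha> power2_eq_square algebra_simps)
  \<comment> \<open>The denominator is nonzero because it is a factor of a product equal to
    1.\<close>
  then have "\<beta>1\<^sup>2 = 1 / (r\<^sup>2 + r * \<tau>1 + 1)"
    by (metis mult_zero_right nonzero_eq_divide_eq zero_neq_one)
  then show b: "\<beta>1\<^sup>2 \<in> \<rat>" using r \<tau> by simp
  have "\<alpha>1 * \<beta>1 = r * \<beta>1\<^sup>2" by (simp add: \<alpha> power2_eq_square)
  then show "\<alpha>1 * \<beta>1 \<in> \<rat>" using b r by simp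
qed

text \<open>The numbers \<alpha>1 and \<beta>1 may be irrational, but their products with \<beta>1
  are rational. Scaling by \<beta>1 and a common denominator therefore makes \<alpha> and \<beta>
  positive integers, and the scaled determinant equation bounds the trace.\<close>

lemma pencil_trace_bounded:
  assumes g: "g \<in> \<rat>" "g \<noteq> 0" and pos: "\<beta>1 > 0" and ab: "\<alpha>1 * \<beta>1 \<in> \<rat>" and bb: "\<beta>1\<^sup>2 \<in> \<rat>"
  obtains C where "\<And>\<tau> \<alpha> \<beta> \<delta>. \<lbrakk>\<alpha> > 0; \<beta> > 0; \<tau> \<ge> 0; \<delta> \<in> SL2Z; det (pencil g \<tau> \<alpha> \<beta>) = 1;
      pencil g \<tau>1 \<alpha>1 \<beta>1 ** \<delta> = pencil g \<tau> \<alpha> \<beta>\<rbrakk> \<Longrightarrow> \<tau> \<le> C"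
proof -
  have "{\<alpha>1 * \<beta>1, \<alpha>1 * \<beta>1 / g, \<beta>1\<^sup>2, \<beta>1\<^sup>2 * g} \<subseteq> \<rat>"
    using g ab bb by simp
  then obtain k :: nat where k0: "k > 0" and
    k: "\<And>x. x \<in> {\<alpha>1 * \<beta>1, \<alpha>1 * \<beta>1 / g, \<beta>1\<^sup>2, \<beta>1\<^sup>2 * g} \<Longrightarrow> real k * x \<in> \<int>"
    using Rats_common_denominator[of "{\<alpha>1 * \<beta>1, \<alpha>1 * \<beta>1 / g, \<beta>1\<^sup>2, \<beta>1\<^sup>2 * g}"] by blast
  have "\<tau> \<le> (k * \<beta>1)\<^sup>2"
    if p: "\<alpha> > 0" "\<beta> > 0" "\<tau> \<ge> 0" and \<delta>: "\<delta> \<in> SL2Z" and d: "det (pencil g \<tau> \<alpha> \<beta>) = 1"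
      and eq: "pencil g \<tau>1 \<alpha>1 \<beta>1 ** \<delta> = pencil g \<tau> \<alpha> \<beta>" for \<tau> \<alpha> \<beta> \<delta>
  proof -
    obtain a b c e where \<delta>e: "\<delta> = mat2 a b c e" using mat2_eta by blast
    have Z: "a \<in> \<int>" "b \<in> \<int>" "c \<in> \<int>" "e \<in> \<int>" using \<delta> by (simp_all add: \<delta>e mat2_in_SL2Z)
    \<comment> \<open>The first row of the equation suffices: it determines both \<alpha> and
      \<beta>.\<close>
    have 11: "\<alpha> = \<alpha>1 * a + \<beta>1 * g * c" and 12: "\<beta> * g = \<alpha>1 * b + \<beta>1 * g * e"
      using eq by (simp_all add: \<delta>e pencil_def mat2_mult mat2_eq_iff)
    define p where "p = k * \<beta>1 * \<alpha>"
    define s where "s = k * \<beta>1 * \<beta>"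
    have "p = (k * (\<alpha>1 * \<beta>1)) * a + (k * (\<beta>1\<^sup>2 * g)) * c"
      by (simp add: p_def 11 power2_eq_square algebra_simps)
    then have pZ: "p \<in> \<int>" using k Z by simp
    have "\<beta> = \<alpha>1 / g * b + \<beta>1 * e" using 12 g by (simp add: field_simps)
    then have "s = (k * (\<alpha>1 * \<beta>1 / g)) * b + (k * \<beta>1\<^sup>2) * e"
      by (simp add: s_def power2_eq_square algebra_simps)
    moreover have "k * (\<alpha>1 * \<beta>1 / g) \<in> \<int>" "k * \<beta>1\<^sup>2 \<in> \<int>" using k by blast+
    ultimately have sZ: "s \<in> \<int>" using Z by (metis Ints_add Ints_mult)
    have "p > 0" "s > 0" using p pos k0 by (simp_all add: p_def s_def)
    then have 1: "p \<ge> 1" "s \<ge> 1" using pZ sZ by (auto elim!: Ints_cases)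
    \<comment> \<open>This is the determinant equation multiplied by
      \<open>(k * \<beta>1)\<^sup>2\<close>. Its right side does not depend on the second
      curve.\<close>
    have "p\<^sup>2 + p * s * \<tau> + s\<^sup>2 = (k * \<beta>1)\<^sup>2 * (\<alpha>\<^sup>2 + \<alpha> * \<beta> * \<tau> + \<beta>\<^sup>2)"
      by (simp add: p_def s_def power2_eq_square algebra_simps)
    also have "\<dots> = (k * \<beta>1)\<^sup>2" using d g by (simp add: det_pencil)
    finally have "p * s * \<tau> \<le> (k * \<beta>1)\<^sup>2" using zero_le_power2[of p] zero_le_power2[of s] by linarith
    moreover have "1 * \<tau> \<le> (p * s) * \<tau>"
      using 1 p(3) mult_mono[of 1 p 1 s] by (intro mult_right_mono) auto
    ultimately show ?thesis by simp
  qed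
  then show ?thesis using that by blast
qed

section \<open>One-parameter groups through hyperbolic matrices\<close>

text \<open>The matrix \<open>A = pencil g \<tau> 0 1\<close> has eigenvalues exp(l) and exp(-l).
  Its logarithm is a combination of I and A, so the whole one-parameter group stays in the span of I
  and A. Conjugation by \<open>g1\<close> moves the group to the base point
  \<open>g1\<close>.\<close>

lemma pencil_one_parameter_subgroup:
  assumes g1: "g1 \<in> carrier SL2R" and g: "g \<noteq> 0" and l: "l > 0" and \<tau>: "\<tau> = 2 * cosh l"
  obtains X where "X \<in> lie_algebra SL2R"
    "\<And>t. mat_exp (t *\<^sub>R X) ** g1 = g1 ** pencil g \<tau> (sinh ((1 - t) * l) / sinh l) (sinh (t * l) / sinh l)"
proof -
  obtain h where h: "h \<in> carrier SL2R" "g1 ** h = mat 1" "h ** g1 = mat 1"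
    using SL2R_inverse[OF g1] .
  \<comment> \<open>This is the logarithm of A: the traceless part \<open>A - cosh l * I\<close> has
    square \<open>(sinh l)\<^sup>2 * I\<close>, and the factor rescales this to
    \<open>l\<^sup>2 * I\<close>.\<close>
  define Y where "Y = (l / sinh l) *\<^sub>R mat2 (- cosh l) g (- 1 / g) (cosh l)"
  define X where "X = g1 ** Y ** h"
  have s: "sinh l > 0" using l by simp
  have "mat2 (- cosh l) g (- 1 / g) (cosh l) ** mat2 (- cosh l) g (- 1 / g) (cosh l)
      = (sinh l)\<^sup>2 *\<^sub>R mat 1"
    using g by (simp add: mat2_mult mat_1_eq_mat2 mat2_scaleR mat2_eq_iff sinh_square_eq flip: power2_eq_square)
  then have YY: "Y ** Y = l\<^sup>2 *\<^sub>R mat 1"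
    using s by (simp add: Y_def scaleR_matrix_mult power2_eq_square)
  have "X ** X = g1 ** (Y ** (h ** g1) ** Y) ** h" by (simp add: X_def matrix_mul_assoc)
  also have "\<dots> = l\<^sup>2 *\<^sub>R mat 1" using h by (simp add: YY scaleR_matrix_mult)
  finally have exp: "mat_exp (t *\<^sub>R X) = cosh (t * l) *\<^sub>R mat 1 + (sinh (t * l) / l) *\<^sub>R X" for t
    using l by (intro mat_exp_scaleR_of_square_scalar) auto
  have 1: "mat_exp (t *\<^sub>R X) ** g1 =
      g1 ** pencil g \<tau> (sinh ((1 - t) * l) / sinh l) (sinh (t * l) / sinh l)" for t
  proof -
    \<comment> \<open>The coefficient of I comes from sinh((1 - t) l) = sinh l cosh(t l) - cosh l
      sinh(t l).\<close>
    have P: "cosh (t * l) *\<^sub>R mat 1 + (sinh (t * l) / l) *\<^sub>R Y =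
        pencil g \<tau> (sinh ((1 - t) * l) / sinh l) (sinh (t * l) / sinh l)"
      using s l g
      by (simp add: Y_def pencil_def mat_1_eq_mat2 mat2_scaleR mat2_add mat2_eq_iff \<tau>
          left_diff_distrib sinh_diff field_simps)
    have "X ** g1 = g1 ** Y" using h by (simp add: X_def flip: matrix_mul_assoc)
    then have "mat_exp (t *\<^sub>R X) ** g1 = g1 ** (cosh (t * l) *\<^sub>R mat 1 + (sinh (t * l) / l) *\<^sub>R Y)"
      by (simp add: exp matrix_add_ldistrib matrix_add_rdistrib scaleR_matrix_mult)
    then show ?thesis by (simp only: P)
  qed
  have "det (mat_exp (t *\<^sub>R X)) = 1" for t
  proof -
    have "det (mat_exp (t *\<^sub>R X)) = det (mat_exp (t *\<^sub>R X) ** g1)"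
      using g1 by (simp add: det_mul carrier_SL2R)
    also have "\<dots> = (sinh ((1 - t) * l) / sinh l)\<^sup>2
        + (sinh ((1 - t) * l) / sinh l) * (sinh (t * l) / sinh l) * \<tau> + (sinh (t * l) / sinh l)\<^sup>2"
      using g1 g by (simp add: 1 det_mul carrier_SL2R det_pencil)
    also have "\<dots> = ((sinh ((1 - t) * l))\<^sup>2 + sinh ((1 - t) * l) * sinh (t * l) * \<tau> + (sinh (t * l))\<^sup>2)
        / (sinh l)\<^sup>2"
      by (simp add: power2_eq_square add_divide_distrib)
    \<comment> \<open>The terms are grouped so that cosh^2 - sinh^2 = 1, at t l and at l, turns the
      first bracket into 1 and the second into 0.\<close>
    also have "(sinh ((1 - t) * l))\<^sup>2 + sinh ((1 - t) * l) * sinh (t * l) * \<tau> + (sinh (t * l))\<^sup>2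
        = (sinh l)\<^sup>2 * ((cosh (t * l))\<^sup>2 - (sinh (t * l))\<^sup>2)
          + (sinh (t * l))\<^sup>2 * ((sinh l)\<^sup>2 + 1 - (cosh l)\<^sup>2)"
      by (simp add: \<tau> left_diff_distrib sinh_diff power2_eq_square algebra_simps)
    also have "\<dots> = (sinh l)\<^sup>2" by (simp add: sinh_square_eq)
    finally show ?thesis using s by simp
  qed
  then have "X \<in> lie_algebra SL2R" by (simp add: lie_algebra_def carrier_SL2R)
  then show ?thesis using that 1 by blast
qed

section \<open>Representatives of a rational coset\<close>

text \<open>Right multiplication by integer matrices acts by column operations. The first row of q
  is g times a coprime integer pair, so it can be reduced to (0, g). The first column is then (0,
  -1/g), and subtracting it n times from the second adds n/g to the trace.\<close>

lemma SL2Q_coset_representatives: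
  assumes q: "q \<in> SL2Q"
  obtains g z where "g > 0" "g \<in> \<rat>" "z \<in> \<rat>"
    "\<And>n::nat. \<exists>\<gamma>\<in>SL2Z. q ** \<gamma> = pencil g (z + n / g) 0 1"
proof -
  obtain x y u v where qe: "q = mat2 x y u v" using mat2_eta by blast
  have Q: "x \<in> \<rat>" "y \<in> \<rat>" "u \<in> \<rat>" "v \<in> \<rat>" and d: "x * v - y * u = 1"
    using q by (simp_all add: qe mat2_in_SL2Q)
  obtain k :: nat where k: "k > 0" "k * x \<in> \<int>" "k * y \<in> \<int>"
    using Rats_common_denominator[of "{x, y}"] Q
    by (metis empty_subsetI finite.emptyI finite.insertI insert_iff insert_subset)
  obtain i :: int where i: "k * x = i" using k(2) by (rule Ints_cases)
  obtain j :: int where j: "k * y = j" using k(3) by (rule Ints_cases)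
  note ij = i j
  define e where "e = gcd i j"
  have "x \<noteq> 0 \<or> y \<noteq> 0" using d by auto
  then have "i \<noteq> 0 \<or> j \<noteq> 0" using ij k(1) by (metis mult_eq_0_iff of_int_0 of_nat_0_eq_iff less_irrefl)
  then have e: "e > 0" by (simp add: e_def)
  obtain r s where rs: "r * i + s * j = e" using bezout_int[of i j] by (auto simp: e_def)
  obtain i' j' where ij': "i = e * i'" "j = e * j'" unfolding e_def by (meson dvdE gcd_dvd1 gcd_dvd2)
  have "e * (r * i' + s * j') = e * 1" using rs by (simp add: ij' algebra_simps)
  then have b: "r * i' + s * j' = 1" using e by simp
  then have bR: "real_of_int r * i' + s * j' = 1" by (metis of_int_1 of_int_add of_int_mult)
  \<comment> \<open>This is the positive generator of the additive group spanned by x and y.\<close>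
  define g where "g = real_of_int e / k"
  define z where "z = u * r + v * s"
  have x: "x = g * i'" "y = g * j'" using ij k by (simp_all add: g_def ij' field_simps)
  have g: "g > 0" "g \<in> \<rat>" using e k by (simp_all add: g_def)
  have c: "u * j' - v * i' = - 1 / g" using d g by (simp add: x field_simps)
  have "\<exists>\<gamma>\<in>SL2Z. q ** \<gamma> = pencil g (z + n / g) 0 1" for n :: nat
  proof
    \<comment> \<open>The first column is orthogonal to (i', j'); the second is the Bezout pair (r,
      s) minus n times the first.\<close>
    show "mat2 j' (r - n * j') (- i') (s + n * i') \<in> SL2Z"
      using bR by (simp add: mat2_in_SL2Z algebra_simps)
    have "x * (r - n * j') + y * (s + n * i') = g * (r * i' + s * j')"
      by (simp add: x algebra_simps)
    moreover have "u * (r - n * j') + v * (s + n * i') = z - n * (u * j' - v * i')"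
      by (simp add: z_def algebra_simps)
    ultimately show "q ** mat2 j' (r - n * j') (- i') (s + n * i') = pencil g (z + n / g) 0 1"
      using c bR by (simp add: qe pencil_def mat2_mult mat2_eq_iff) (simp add: x)
  qed
  moreover have "z \<in> \<rat>" using Q by (simp add: z_def)
  ultimately show ?thesis using that g by blast
qed

section \<open>Density of the rational matrices\<close>

lemma tendsto_mat2:
  assumes "(a \<longlongrightarrow> a') F" "(b \<longlongrightarrow> b') F" "(c \<longlongrightarrow> c') F" "(d \<longlongrightarrow> d') F"
  shows "((\<lambda>n. mat2 (a n) (b n) (c n) (d n)) \<longlongrightarrow> mat2 a' b' c' d') F"
proof (rule vec_tendstoI, rule vec_tendstoI)
  fix i j :: 2
  show "((\<lambda>n. mat2 (a n) (b n) (c n) (d n) $ i $ j) \<longlongrightarrow> mat2 a' b' c' d' $ i $ j) F"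
    using exhaust_2[of i] exhaust_2[of j] assms by auto
qed

lemma tendsto_matrix_mult_left:
  fixes A :: "real^'m^'n"
  assumes "(f \<longlongrightarrow> B) F"
  shows "((\<lambda>n. A ** f n) \<longlongrightarrow> A ** B) F"
proof (rule vec_tendstoI, rule vec_tendstoI)
  fix i j
  have "((\<lambda>n. \<Sum>k\<in>UNIV. A $ i $ k * f n $ k $ j) \<longlongrightarrow> (\<Sum>k\<in>UNIV. A $ i $ k * B $ k $ j)) F"
    by (intro tendsto_intros assms)
  then show "((\<lambda>n. (A ** f n) $ i $ j) \<longlongrightarrow> (A ** B) $ i $ j) F"
    by (simp add: matrix_matrix_mult_def)
qed

text \<open>Three entries are approximated freely and the determinant condition is solved for the
  fourth. This divides by an entry of the first row with nonzero limit, which needs nonzero rational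
  approximations.\<close>

lemma SL2Q_dense:
  assumes "A \<in> carrier SL2R"
  obtains Q where "\<And>n::nat. Q n \<in> SL2Q" "Q \<longlonglongrightarrow> A"
proof -
  have rat: "\<exists>f. (\<forall>n::nat. f n \<in> \<rat>) \<and> f \<longlonglongrightarrow> x" for x :: real
    using closure_sequential[of x \<rat>] by (simp add: Rats_closure_real)
  have rat': "\<exists>f. (\<forall>n::nat. f n \<in> \<rat> \<and> f n \<noteq> 0) \<and> f \<longlonglongrightarrow> x" if x: "x \<noteq> 0" for x :: real
  proof -
    obtain f where f: "\<And>n::nat. f n \<in> \<rat>" "f \<longlonglongrightarrow> x" using rat by blast
    have ev: "eventually (\<lambda>n. f n \<noteq> 0) sequentially"
      using f(2) x by (rule tendsto_imp_eventually_ne)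
    \<comment> \<open>Replacing zeros by 1 alters only finitely many terms.\<close>
    have "(\<lambda>n. if f n = 0 then 1 else f n) \<longlonglongrightarrow> x"
      by (rule Lim_transform_eventually[OF f(2)]) (use ev in eventually_elim, simp)
    then show ?thesis using f(1) by (intro exI[of _ "\<lambda>n. if f n = 0 then 1 else f n"]) auto
  qed
  obtain a b c d where Ae: "A = mat2 a b c d" using mat2_eta by blast
  have D: "a * d - b * c = 1" using assms by (simp add: Ae carrier_SL2R det_mat2)
  obtain fa fb fc fd where f: "\<And>n::nat. fa n \<in> \<rat>" "\<And>n::nat. fb n \<in> \<rat>" "\<And>n::nat. fc n \<in> \<rat>" "\<And>n::nat. fd n \<in> \<rat>"
    "fa \<longlonglongrightarrow> a" "fb \<longlonglongrightarrow> b" "fc \<longlonglongrightarrow> c" "fd \<longlonglongrightarrow> d"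
    using rat by metis
  show ?thesis
  proof (cases "a = 0")
    case False
    then obtain h where h: "\<And>n::nat. h n \<in> \<rat> \<and> h n \<noteq> 0" "h \<longlonglongrightarrow> a" using rat' by blast
    have "(\<lambda>n. mat2 (h n) (fb n) (fc n) ((1 + fb n * fc n) / h n)) \<longlonglongrightarrow>
        mat2 a b c ((1 + b * c) / a)"
      by (intro tendsto_mat2 tendsto_intros f h False)
    moreover have "(1 + b * c) / a = d" using D False by (simp add: field_simps)
    moreover have "mat2 (h n) (fb n) (fc n) ((1 + fb n * fc n) / h n) \<in> SL2Q" for n
      using f h(1)[of n] by (simp add: mat2_in_SL2Q)
    ultimately show ?thesis
      using that[of "\<lambda>n. mat2 (h n) (fb n) (fc n) ((1 + fb n * fc n) / h n)"] by (simp add: Ae)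
  next
    case True
    then have b: "b \<noteq> 0" using D by auto
    then obtain h where h: "\<And>n::nat. h n \<in> \<rat> \<and> h n \<noteq> 0" "h \<longlonglongrightarrow> b" using rat' by blast
    have "(\<lambda>n. mat2 (fa n) (h n) ((fa n * fd n - 1) / h n) (fd n)) \<longlonglongrightarrow>
        mat2 a b ((a * d - 1) / b) d"
      by (intro tendsto_mat2 tendsto_intros f h b)
    moreover have "(a * d - 1) / b = c" using D b by (simp add: field_simps)
    moreover have "mat2 (fa n) (h n) ((fa n * fd n - 1) / h n) (fd n) \<in> SL2Q" for n
      using f h(1)[of n] by (simp add: mat2_in_SL2Q)
    ultimately show ?thesis
      using that[of "\<lambda>n. mat2 (fa n) (h n) ((fa n * fd n - 1) / h n) (fd n)"] by (simp add: Ae)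
  qed
qed

section \<open>Infinitely many curves against a finite set\<close>

text \<open>Writing the second point as a translate by q serves both the first claim and the
  approximation of arbitrary pairs.\<close>

lemma not_blockable_rational_translate:
  assumes g1: "g1 \<in> carrier SL2R" and q: "q \<in> SL2Q"
  shows "\<not> blockable SL2R SL2Z (g1 <#\<^bsub>SL2R\<^esub> SL2Z) ((g1 ** q) <#\<^bsub>SL2R\<^esub> SL2Z)"
proof
  interpret group SL2R by (rule group_SL2R)
  interpret \<Gamma>: subgroup SL2Z SL2R by (rule subgroup_SL2Z)
  let ?m1 = "g1 <#\<^bsub>SL2R\<^esub> SL2Z" and ?m2 = "(g1 ** q) <#\<^bsub>SL2R\<^esub> SL2Z"
  assume "blockable SL2R SL2Z ?m1 ?m2"
  then obtain B where fin: "finite B" and B12: "?m1 \<notin> B" "?m2 \<notin> B"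
    and block: "\<And>c. connecting_curve SL2R SL2Z ?m1 ?m2 c \<Longrightarrow> c ` {0..1} \<inter> B \<noteq> {}"
    unfolding blockable_def blocking_set_def by blast
  have qc: "q \<in> carrier SL2R" using q by (simp add: SL2Q_def)
  obtain g z where g: "g > 0" "g \<in> \<rat>" and z: "z \<in> \<rat>"
    and rep: "\<And>n::nat. \<exists>\<gamma>\<in>SL2Z. q ** \<gamma> = pencil g (z + n / g) 0 1"
    using SL2Q_coset_representatives[OF q] by blast
  define \<tau> where "\<tau> n = z + real n / g" for n
  have \<tau>Q: "\<tau> n \<in> \<rat>" for n using g z by (simp add: \<tau>_def)
  have \<tau>inj: "\<tau> m \<noteq> \<tau> n" if "m \<noteq> n" for m n using that g by (simp add: \<tau>_def)
  have unbounded: "\<exists>n0. \<forall>n\<ge>n0. \<tau> n > C" for C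
  proof -
    obtain n0 :: nat where n0: "real n0 > (C - z) * g" using reals_Archimedean2 by blast
    have "\<tau> n > C" if "n \<ge> n0" for n
    proof -
      have "real n > (C - z) * g" using that n0 by linarith
      then show ?thesis using g by (simp add: \<tau>_def field_simps)
    qed
    then show ?thesis by blast
  qed
  \<comment> \<open>\<open>R n b\<close> records that b has the form of an interior point of the
    n-th curve.\<close>
  define R where "R n b \<longleftrightarrow> (\<exists>\<alpha> \<beta>. \<alpha> > 0 \<and> \<beta> > 0 \<and> det (pencil g (\<tau> n) \<alpha> \<beta>) = 1 \<and>
      (g1 ** pencil g (\<tau> n) \<alpha> \<beta>) <#\<^bsub>SL2R\<^esub> SL2Z = b)" for n b
  have hit: "\<exists>b\<in>B. R n b" if n: "\<tau> n > 2" for n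
  proof -
    \<comment> \<open>A trace above 2 makes the representative hyperbolic, with translation
      parameter \<open>l > 0\<close>.\<close>
    define l where "l = arcosh (\<tau> n / 2)"
    have l: "l > 0" "\<tau> n = 2 * cosh l" using n by (simp_all add: l_def cosh_arcosh_real)
    obtain X where X: "X \<in> lie_algebra SL2R" and
      Xe: "\<And>t. mat_exp (t *\<^sub>R X) ** g1 =
        g1 ** pencil g (\<tau> n) (sinh ((1 - t) * l) / sinh l) (sinh (t * l) / sinh l)"
      using pencil_one_parameter_subgroup[OF g1 _ l, of g] g by auto
    have Xc: "mat_exp (t *\<^sub>R X) \<in> carrier SL2R" for t using X by (simp add: lie_algebra_def)
    define c where "c t = mat_exp (t *\<^sub>R X) <#\<^bsub>SL2R\<^esub> ?m1" for t
    have ce: "c t = (g1 ** pencil g (\<tau> n) (sinh ((1 - t) * l) / sinh l) (sinh (t * l) / sinh l))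
        <#\<^bsub>SL2R\<^esub> SL2Z" for t
      unfolding c_def using lcos_m_assoc[OF \<Gamma>.subset Xc g1] by (simp add: Xe)
    have p0: "pencil g \<tau>' 1 0 = mat 1" for \<tau>' by (simp add: pencil_def mat_1_eq_mat2)
    have c0: "c 0 = ?m1" using l by (simp add: ce p0)
    obtain \<gamma> where \<gamma>: "\<gamma> \<in> SL2Z" "q ** \<gamma> = pencil g (\<tau> n) 0 1" using rep \<tau>_def by metis
    \<comment> \<open>The curve ends at the chosen representative, which differs from q by \<gamma>
      and so gives the same coset.\<close>
    have "c 1 = ((g1 ** q) ** \<gamma>) <#\<^bsub>SL2R\<^esub> SL2Z"
      using l by (simp add: ce \<gamma>(2) flip: matrix_mul_assoc)
    also have "\<dots> = (g1 ** q) <#\<^bsub>SL2R\<^esub> (\<gamma> <#\<^bsub>SL2R\<^esub> SL2Z)"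
      using lcos_m_assoc[OF \<Gamma>.subset, of "g1 ** q" \<gamma>] m_closed[OF g1 qc] \<gamma>(1) \<Gamma>.subset by auto
    also have "\<gamma> <#\<^bsub>SL2R\<^esub> SL2Z = SL2Z"
      using \<gamma>(1) \<Gamma>.subset subgroup_SL2Z by (intro coset_join3) auto
    finally have c1: "c 1 = ?m2" .
    have "?m1 \<in> lcosets\<^bsub>SL2R\<^esub> SL2Z" using g1 by (auto simp: LCOSETS_def)
    then have "connecting_curve SL2R SL2Z ?m1 ?m2 c"
      unfolding connecting_curve_def using X c0 c1 c_def by blast
    then obtain t where t: "0 \<le> t" "t \<le> 1" "c t \<in> B" using block[of c] by auto
    \<comment> \<open>A blocking set avoids both ends, so t is interior and both sinh coefficients
      are positive.\<close>
    then have t': "0 < t" "t < 1" using c0 c1 B12 by (metis order_le_less)+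
    have "det (mat_exp (t *\<^sub>R X) ** g1) = 1" using Xc[of t] g1 by (simp add: carrier_SL2R det_mul)
    then have "det (pencil g (\<tau> n) (sinh ((1 - t) * l) / sinh l) (sinh (t * l) / sinh l)) = 1"
      using g1 by (simp add: Xe carrier_SL2R det_mul)
    then have "R n (c t)" unfolding R_def ce using t' l
      by (intro exI[of _ "sinh ((1 - t) * l) / sinh l"] exI[of _ "sinh (t * l) / sinh l"]) simp
    then show ?thesis using t by blast
  qed
  obtain n0 where n0: "\<And>n. n \<ge> n0 \<Longrightarrow> \<tau> n > 2" using unbounded[of 2] by blast
  have "\<exists>b\<in>B. infinite {n \<in> {n0..}. R n b}"
    using fin hit n0 by (intro pigeonhole_infinite_rel) (auto simp: infinite_Ici)
  then obtain b where inf: "infinite {n \<in> {n0..}. R n b}" by blast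
  then obtain n1 where n1: "n1 \<ge> n0" "R n1 b" using not_finite_existsD by force
  then obtain \<alpha>1 \<beta>1 where p1: "\<alpha>1 > 0" "\<beta>1 > 0" and d1: "det (pencil g (\<tau> n1) \<alpha>1 \<beta>1) = 1"
    and b1: "(g1 ** pencil g (\<tau> n1) \<alpha>1 \<beta>1) <#\<^bsub>SL2R\<^esub> SL2Z = b"
    unfolding R_def by blast
  \<comment> \<open>Two representatives of the coset b differ by an element of \<open>SL2Z\<close>
    on the right; \<open>g1\<close> cancels on the left.\<close>
  have meet: "\<exists>\<alpha> \<beta> \<delta>. \<alpha> > 0 \<and> \<beta> > 0 \<and> det (pencil g (\<tau> n) \<alpha> \<beta>) = 1 \<and> \<delta> \<in> SL2Z \<and>
      pencil g (\<tau> n1) \<alpha>1 \<beta>1 ** \<delta> = pencil g (\<tau> n) \<alpha> \<beta>" if R: "R n b" for n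
  proof -
    obtain \<alpha> \<beta> where p: "\<alpha> > 0" "\<beta> > 0" and d: "det (pencil g (\<tau> n) \<alpha> \<beta>) = 1"
      and b: "(g1 ** pencil g (\<tau> n) \<alpha> \<beta>) <#\<^bsub>SL2R\<^esub> SL2Z = b"
      using R unfolding R_def by blast
    have "g1 ** pencil g (\<tau> n) \<alpha> \<beta> \<in> b"
      unfolding b[symmetric] using g1 d
      by (intro lcos_self subgroup_SL2Z) (simp add: carrier_SL2R det_mul)
    then obtain \<delta> where \<delta>: "\<delta> \<in> SL2Z" "g1 ** pencil g (\<tau> n1) \<alpha>1 \<beta>1 ** \<delta> = g1 ** pencil g (\<tau> n) \<alpha> \<beta>"
      unfolding b1[symmetric] l_coset_def by auto
    obtain h where "h ** g1 = mat 1" using SL2R_inverse[OF g1] by blast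
    then have "pencil g (\<tau> n1) \<alpha>1 \<beta>1 ** \<delta> = pencil g (\<tau> n) \<alpha> \<beta>"
      using \<delta>(2) by (metis matrix_mul_assoc matrix_mul_lid)
    then show ?thesis using p d \<delta>(1) by blast
  qed
  \<comment> \<open>A second index supplies the different trace needed for rationality.\<close>
  have "infinite ({n \<in> {n0..}. R n b} - {n1})" using inf by simp
  then obtain n2 where n2: "n2 \<noteq> n1" "R n2 b" 
    by (metis (mono_tags, lifting) Diff_iff ex_in_conv finite.emptyI insertI1 mem_Collect_eq)
  obtain \<alpha>2 \<beta>2 \<delta>2 where "\<beta>2 > 0" "\<delta>2 \<in> SL2Z"
    "pencil g (\<tau> n1) \<alpha>1 \<beta>1 ** \<delta>2 = pencil g (\<tau> n2) \<alpha>2 \<beta>2" using meet[OF n2(2)] by blast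
  then have rat: "\<alpha>1 * \<beta>1 \<in> \<rat>" "\<beta>1\<^sup>2 \<in> \<rat>"
    using pencil_coeffs_rational[of g "\<tau> n1" "\<tau> n2" \<alpha>1 \<beta>1 \<beta>2 \<delta>2 \<alpha>2] g \<tau>Q \<tau>inj n2(1) d1 p1 by auto
  obtain C where C: "\<And>\<tau>' \<alpha> \<beta> \<delta>. \<lbrakk>\<alpha> > 0; \<beta> > 0; \<tau>' \<ge> 0; \<delta> \<in> SL2Z; det (pencil g \<tau>' \<alpha> \<beta>) = 1;
      pencil g (\<tau> n1) \<alpha>1 \<beta>1 ** \<delta> = pencil g \<tau>' \<alpha> \<beta>\<rbrakk> \<Longrightarrow> \<tau>' \<le> C"
    using pencil_trace_bounded[of g \<beta>1 \<alpha>1 "\<tau> n1"] g p1 rat by auto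
  obtain n3 where n3: "\<And>n. n \<ge> n3 \<Longrightarrow> \<tau> n > C" using unbounded by blast
  \<comment> \<open>The bound C depends only on the first curve, so an index far enough along the
    infinite set contradicts it.\<close>
  obtain n where n: "n \<ge> n0" "R n b" "n \<ge> n3"
    using inf unfolding infinite_nat_iff_unbounded_le by blast
  have "\<tau> n \<le> C" using meet[OF n(2)] C n0[OF n(1)] by (metis less_eq_real_def order_less_trans zero_less_numeral)
  then show False using n3[OF n(3)] by simp
qed

theorem theorem1:
  shows "(\<forall>g1\<in>carrier SL2R. \<forall>g2\<in>carrier SL2R.
            inv\<^bsub>SL2R\<^esub> g1 \<otimes>\<^bsub>SL2R\<^esub> g2 \<in> SL2Q \<longrightarrow>
            \<not> blockable SL2R SL2Z (g1 <#\<^bsub>SL2R\<^esub> SL2Z) (g2 <#\<^bsub>SL2R\<^esub> SL2Z))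
       \<and> prod_topology M2_topology M2_topology closure_of
            {(m1, m2). m1 \<in> M2 \<and> m2 \<in> M2 \<and> \<not> blockable SL2R SL2Z m1 m2}
          = M2 \<times> M2"
proof (intro conjI ballI impI)
  interpret group SL2R by (rule group_SL2R)
  fix g1 g2
  assume g: "g1 \<in> carrier SL2R" "g2 \<in> carrier SL2R" and q: "inv\<^bsub>SL2R\<^esub> g1 \<otimes>\<^bsub>SL2R\<^esub> g2 \<in> SL2Q"
  have "g1 \<otimes>\<^bsub>SL2R\<^esub> (inv\<^bsub>SL2R\<^esub> g1 \<otimes>\<^bsub>SL2R\<^esub> g2) = g2"
    using g by (metis inv_closed m_assoc r_inv l_one)
  then show "\<not> blockable SL2R SL2Z (g1 <#\<^bsub>SL2R\<^esub> SL2Z) (g2 <#\<^bsub>SL2R\<^esub> SL2Z)"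
    using not_blockable_rational_translate[OF g(1) q] by simp
next
  let ?N = "{(m1, m2). m1 \<in> M2 \<and> m2 \<in> M2 \<and> \<not> blockable SL2R SL2Z m1 m2}"
  let ?T = "prod_topology M2_topology M2_topology"
  have top: "topspace ?T = M2 \<times> M2" by (simp add: topspace_coset_topology)
  \<comment> \<open>It suffices to keep \<open>m1\<close> fixed and move \<open>m2\<close>: rational
    approximations Q n of the inverse of \<open>g1\<close> times \<open>g2\<close> give
    \<open>g1 ** Q n\<close> tending to \<open>g2\<close>.\<close>
  have "(m1, m2) \<in> ?T closure_of ?N" if m: "m1 \<in> M2" "m2 \<in> M2" for m1 m2
    unfolding in_closure_of
  proof (intro conjI allI impI)
    show "(m1, m2) \<in> topspace ?T" using m by (simp add: topspace_coset_topology)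
    fix W assume "(m1, m2) \<in> W \<and> openin ?T W"
    then obtain U V where UV: "openin M2_topology V" "m1 \<in> U" "m2 \<in> V" "U \<times> V \<subseteq> W"
      unfolding openin_prod_topology_alt by blast
    obtain g1 g2 where g: "g1 \<in> carrier SL2R" "g2 \<in> carrier SL2R"
      and e: "m1 = g1 <#\<^bsub>SL2R\<^esub> SL2Z" "m2 = g2 <#\<^bsub>SL2R\<^esub> SL2Z"
      using m by (auto simp: LCOSETS_def)
    obtain h where h: "h \<in> carrier SL2R" "g1 ** h = mat 1" using SL2R_inverse[OF g(1)] by blast
    have "h ** g2 \<in> carrier SL2R" using h(1) g(2) by (simp add: carrier_SL2R det_mul)
    then obtain Q where Q: "\<And>n::nat. Q n \<in> SL2Q" "Q \<longlonglongrightarrow> h ** g2" using SL2Q_dense by blast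
    have lim: "(\<lambda>n. g1 ** Q n) \<longlonglongrightarrow> g2"
      using tendsto_matrix_mult_left[OF Q(2), of g1] h(2) by (simp add: matrix_mul_assoc)
    obtain O' where O: "open O'" "{x \<in> carrier SL2R. x <#\<^bsub>SL2R\<^esub> SL2Z \<in> V} = carrier SL2R \<inter> O'"
      using UV(1) unfolding openin_coset_topology openin_open by blast
    \<comment> \<open>The convergence takes place in the group; the quotient topology transfers it,
      as the preimage of V is relatively open.\<close>
    have "g2 \<in> O'" using O(2) g(2) UV(3) e by blast
    then have "eventually (\<lambda>n. g1 ** Q n \<in> O') sequentially"
      using lim O(1) by (auto dest: topological_tendstoD)
    then obtain n where n: "g1 ** Q n \<in> O'" by (auto simp: eventually_sequentially)
    have c: "g1 ** Q n \<in> carrier SL2R"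
      using g(1) Q(1)[of n] by (simp add: carrier_SL2R SL2Q_def det_mul)
    then have "(g1 ** Q n) <#\<^bsub>SL2R\<^esub> SL2Z \<in> V" using n O(2) by blast
    moreover have "(g1 ** Q n) <#\<^bsub>SL2R\<^esub> SL2Z \<in> M2" using c by (auto simp: LCOSETS_def)
    ultimately show "\<exists>y. y \<in> ?N \<and> y \<in> W"
      using not_blockable_rational_translate[OF g(1) Q(1)[of n]] UV m(1) e(1)
      by (intro exI[of _ "(m1, (g1 ** Q n) <#\<^bsub>SL2R\<^esub> SL2Z)"]) auto
  qed
  then show "?T closure_of ?N = M2 \<times> M2"
    using closure_of_subset_topspace[of ?T ?N] unfolding top by auto
qed

end
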